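(* Let $A$ be Hurwitz, let $\mathcal I=\{\mathcal I_1,\dots,\mathcal I_r\}$ be a fixed partition of $\{1,\dots,n\}$ into nonempty sets, and let $\Phi_\kappa\in\mathbb R^{n\times n}$ be the symmetric positive semidefinite matrix defined in the context. For each $i=1,\dots,r$, the global optimum of $$\underset{\hat w_{\mathcal I_i}}{\text{maximize}}\quad \hat w_{\mathcal I_i}^T\,\Phi_{\kappa[\mathcal I_i,\mathcal I_i]}\,\hat w_{\mathcal I_i}\qquad\text{subject to}\quad\|\hat w_{\mathcal I_i}\|_2=1$$ is attained at $\hat w_{\mathcal I_i}=\bar v(\Phi_{\kappa[\mathcal I_i,\mathcal I_i]})$, a unit-norm eigenvector of $\Phi_{\kappa[\mathcal I_i,\mathcal I_i]}$ for its largest eigenvalue.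
   Context: System: $\dot x=Ax+Bu+B_dd$ with $x\in\mathbb R^n$, $d\in\mathbb R^{n_b}$; $Q=Q^T\succeq0$, $R=R^T\succ0$, $G=BR^{-1}B^T$, with $(Q^{\frac T2},A)$ observable, $(A,BR^{-\frac12})$ stabilizable, $(A,B_d)$ controllable. $X\succ0$ is the unique stabilizing solution of $A^TX+XA+Q-XGX=0$. The Hamiltonian $H=\begin{bmatrix}A&-G\\-Q&-A^T\end{bmatrix}$ is assumed diagonalizable with stable invariant subspace spanned by the columns of $\begin{bmatrix}Y\\Z\end{bmatrix}$, $H\begin{bmatrix}Y\\Z\end{bmatrix}=\begin{bmatrix}Y\\Z\end{bmatrix}\mathrm{diag}(\lambda_1^-,\dots,\lambda_n^-)$, $0>\lambda_1^->\dots>\lambda_n^-$. For $\kappa<n$, $\Phi_\kappa=Y_1(\Omega_1B_dB_d^T\Omega_1^T\circ\mathcal C_{1,1})Y_1^T$, where $Y_1$ is the first $\kappa$ columns of $Y$, $\Omega_1$ the first $\kappa$ rows of $Y^{-1}$, $\circ$ is the Hadamard product and $\mathcal C_{1,1}\in\mathbb R^{\kappa\times\kappa}$ has entries $-\frac1{\lambda_i^-+\lambda_j^-}$. $\Phi_{\kappa[\mathcal I_i,\mathcal I_i]}$ is the principal submatrix of $\Phi_\kappa$ with rows and columns indexed by $\mathcal I_i$; $\bar v(M)$ denotes a right eigenvector of $M$ for the eigenvalue with largest real part; $\hat w_{\mathcal I_i}$ is the subvector of $\hat w\in\mathbb R^n$ indexed by $\mathcal I_i$. *)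

theory Defs
  imports
    Complex_Main
    "HOL-Library.Disjoint_Sets"
    "Jordan_Normal_Form.Spectral_Radius"
    "Jordan_Normal_Form.Gauss_Jordan_Elimination"
    "Jordan_Normal_Form.VS_Connect"
    "Jordan_Normal_Form.DL_Submatrix"
begin

text \<open>
  Matrices and vectors are those of Jordan_Normal_Form, so indices run over
  \<open>0, \<dots>, n - 1\<close> instead of \<open>1, \<dots>, n\<close>.
\<close>

abbreviation complexify :: "real mat \<Rightarrow> complex mat" where
  "complexify \<equiv> map_mat complex_of_real"

definition norm2 :: "real vec \<Rightarrow> real" where
  "norm2 v = sqrt (v \<bullet> v)"

definition symmetric_psd :: "nat \<Rightarrow> real mat \<Rightarrow> bool" where
  "symmetric_psd n M \<longleftrightarrow> M \<in> carrier_mat n n \<and> transpose_mat M = M \<and>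
     (\<forall>v \<in> carrier_vec n. 0 \<le> v \<bullet> (M *\<^sub>v v))"

definition symmetric_pd :: "nat \<Rightarrow> real mat \<Rightarrow> bool" where
  "symmetric_pd n M \<longleftrightarrow> M \<in> carrier_mat n n \<and> transpose_mat M = M \<and>
     (\<forall>v \<in> carrier_vec n. v \<noteq> 0\<^sub>v n \<longrightarrow> 0 < v \<bullet> (M *\<^sub>v v))"

text \<open>
  \<open>S\<close> plays the role of $M^{1/2}$ in the factorization $M = M^{1/2} M^{T/2}$, where
  $M^{T/2} = (M^{1/2})^T$. Any square factor is admitted, in particular the symmetric
  square root.
\<close>
definition sqrt_factor :: "nat \<Rightarrow> real mat \<Rightarrow> real mat \<Rightarrow> bool" where
  "sqrt_factor n M S \<longleftrightarrow> S \<in> carrier_mat n n \<and> S * transpose_mat S = M"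

text \<open>Only meaningful for invertible matrices.\<close>
definition mat_inv :: "real mat \<Rightarrow> real mat" where
  "mat_inv M = the (mat_inverse M)"

definition hadamard :: "real mat \<Rightarrow> real mat \<Rightarrow> real mat" where
  "hadamard M N = mat (dim_row M) (dim_col M) (\<lambda>(i, j). M $$ (i, j) * N $$ (i, j))"

definition diagonalizable :: "complex mat \<Rightarrow> bool" where
  "diagonalizable M \<longleftrightarrow> (\<exists>D. diagonal_mat D \<and> similar_mat M D)"

definition hurwitz :: "real mat \<Rightarrow> bool" where
  "hurwitz M \<longleftrightarrow> (\<forall>\<nu>. eigenvalue (complexify M) \<nu> \<longrightarrow> Re \<nu> < 0)"

text \<open>\<open>x\<close> solves $\dot x = A x + f$ on $[0, T]$, derivatives being taken componentwise.\<close>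
definition lin_traj ::
    "nat \<Rightarrow> real mat \<Rightarrow> (real \<Rightarrow> real vec) \<Rightarrow> real \<Rightarrow> (real \<Rightarrow> real vec) \<Rightarrow> bool" where
  "lin_traj n A f T x \<longleftrightarrow>
     (\<forall>t \<in> {0..T}. x t \<in> carrier_vec n \<and>
        (\<forall>j < n. ((\<lambda>s. x s $ j) has_real_derivative (A *\<^sub>v x t + f t) $ j)
                  (at t within {0..T})))"

text \<open>For \<open>A\<close> of size \<open>n \<times> n\<close> and \<open>B\<close> of size \<open>n \<times> m\<close>.\<close>
definition controllable :: "nat \<Rightarrow> nat \<Rightarrow> real mat \<Rightarrow> real mat \<Rightarrow> bool" where
  "controllable n m A B \<longleftrightarrow>
     (\<exists>T > 0. \<forall>x\<^sub>0 \<in> carrier_vec n. \<forall>x\<^sub>1 \<in> carrier_vec n. \<exists>u x.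
        (\<forall>t \<in> {0..T}. u t \<in> carrier_vec m) \<and>
        (\<forall>j < m. continuous_on {0..T} (\<lambda>t. u t $ j)) \<and>
        lin_traj n A (\<lambda>t. B *\<^sub>v u t) T x \<and> x 0 = x\<^sub>0 \<and> x T = x\<^sub>1)"

text \<open>The free response determines the initial state from the output over a finite interval.\<close>
definition observable :: "nat \<Rightarrow> real mat \<Rightarrow> real mat \<Rightarrow> bool" where
  "observable n C A \<longleftrightarrow>
     (\<exists>T > 0. \<forall>x x'.
        lin_traj n A (\<lambda>t. 0\<^sub>v n) T x \<longrightarrow> lin_traj n A (\<lambda>t. 0\<^sub>v n) T x' \<longrightarrow>
        (\<forall>t \<in> {0..T}. C *\<^sub>v x t = C *\<^sub>v x' t) \<longrightarrow> x 0 = x' 0)"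

definition stabilizable :: "nat \<Rightarrow> nat \<Rightarrow> real mat \<Rightarrow> real mat \<Rightarrow> bool" where
  "stabilizable n m A B \<longleftrightarrow> (\<exists>F \<in> carrier_mat m n. hurwitz (A + B * F))"

definition stabilizing_solution ::
    "nat \<Rightarrow> real mat \<Rightarrow> real mat \<Rightarrow> real mat \<Rightarrow> real mat \<Rightarrow> bool" where
  "stabilizing_solution n A G Q X \<longleftrightarrow>
     X \<in> carrier_mat n n \<and> transpose_mat X = X \<and>
     transpose_mat A * X + X * A + Q - X * G * X = 0\<^sub>m n n \<and>
     hurwitz (A - G * X)"

definition hamiltonian :: "real mat \<Rightarrow> real mat \<Rightarrow> real mat \<Rightarrow> real mat" where
  "hamiltonian A G Q = four_block_mat A (- G) (- Q) (- transpose_mat A)"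

text \<open>
  The real vectors lying in the sum of the complex generalized eigenspaces of \<open>M\<close> for
  eigenvalues in the open left half-plane.
\<close>
definition stable_subspace :: "nat \<Rightarrow> real mat \<Rightarrow> real vec set" where
  "stable_subspace N M =
     {v \<in> carrier_vec N.
        map_vec complex_of_real v \<in>
          LinearCombinations.module.span class_ring (module_vec TYPE(complex) N)
            {w \<in> carrier_vec N. \<exists>\<nu> k. Re \<nu> < 0 \<and>
               ((complexify M - \<nu> \<cdot>\<^sub>m 1\<^sub>m N) ^\<^sub>m k) *\<^sub>v w = 0\<^sub>v N}}"

definition Phi :: "nat \<Rightarrow> nat \<Rightarrow> real mat \<Rightarrow> (nat \<Rightarrow> real) \<Rightarrow> real mat \<Rightarrow> real mat" where
  "Phi n \<kappa> Y lam B\<^sub>d =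
     (let Y\<^sub>1 = mat n \<kappa> (\<lambda>(i, j). Y $$ (i, j));
          \<Omega>\<^sub>1 = mat \<kappa> n (\<lambda>(i, j). mat_inv Y $$ (i, j));
          C = mat \<kappa> \<kappa> (\<lambda>(i, j). - (1 / (lam i + lam j)))
      in Y\<^sub>1 * hadamard (\<Omega>\<^sub>1 * B\<^sub>d * transpose_mat B\<^sub>d * transpose_mat \<Omega>\<^sub>1) C * transpose_mat Y\<^sub>1)"

abbreviation principal_submatrix :: "real mat \<Rightarrow> nat set \<Rightarrow> real mat" where
  "principal_submatrix M J \<equiv> submatrix M J J"

text \<open>
  \<open>v\<close> is a (real) choice of $\bar v(M)$: a right eigenvector for an eigenvalue whose real
  part is maximal among all complex eigenvalues of \<open>M\<close>.
\<close>
definition rightmost_eigenvector :: "real mat \<Rightarrow> real vec \<Rightarrow> bool" where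
  "rightmost_eigenvector M v \<longleftrightarrow>
     (\<exists>\<mu>. eigenvector (complexify M) (map_vec complex_of_real v) \<mu> \<and>
          (\<forall>\<nu>. eigenvalue (complexify M) \<nu> \<longrightarrow> Re \<nu> \<le> Re \<mu>))"

end

theory Submission
  imports Defs
begin

text \<open>
  Writing \<open>\<Omega>\<^sub>1 B\<^sub>d = N\<close>, the form of \<open>\<Phi>\<^sub>\<kappa>\<close> is a sum over the columns of \<open>N\<close> of forms with the
  Cauchy kernel \<open>1 / (a\<^sub>i + a\<^sub>j)\<close>, \<open>a\<^sub>i = - \<lambda>\<^sub>i > 0\<close>, and this kernel is positive semidefinite.
  For a symmetric matrix \<open>M\<close> let \<open>s\<close> be the supremum of the Rayleigh quotient. Then \<open>s I - M\<close> is
  positive semidefinite; were it nonsingular, it would be bounded below by a positive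
  multiple of the identity, and \<open>s\<close> could be decreased. So \<open>s\<close> is an eigenvalue, and it bounds
  the real part of every complex eigenvalue. This avoids compactness of the unit sphere.
\<close>

section \<open>Elementary facts on real quadratic forms\<close>

lemma quad_form_sum:
  fixes M :: "real mat"
  assumes "M \<in> carrier_mat k k" "u \<in> carrier_vec k" "w \<in> carrier_vec k"
  shows "u \<bullet> (M *\<^sub>v w) = (\<Sum>i<k. \<Sum>j<k. u $ i * M $$ (i, j) * w $ j)"
  using assms
  by (auto simp: scalar_prod_def sum_distrib_left mult.assoc lessThan_atLeast0 intro!: sum.cong)

lemma scalar_prod_self_nonneg: "0 \<le> (v :: real vec) \<bullet> v"
  by (simp add: scalar_prod_def sum_nonneg)

lemma scalar_prod_self_eq_0_iff:
  assumes "(v :: real vec) \<in> carrier_vec n"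
  shows "v \<bullet> v = 0 \<longleftrightarrow> v = 0\<^sub>v n"
  using assms by (auto simp: scalar_prod_def sum_nonneg_eq_0_iff intro!: eq_vecI)

lemma symmetric_form_commute:
  assumes "(M :: real mat) \<in> carrier_mat k k" "transpose_mat M = M"
    and "u \<in> carrier_vec k" "w \<in> carrier_vec k"
  shows "u \<bullet> (M *\<^sub>v w) = w \<bullet> (M *\<^sub>v u)"
  using assms transpose_vec_mult_scalar[of M k k w u]
  by (metis comm_scalar_prod mult_mat_vec_carrier)

section \<open>Positive semidefiniteness of \<Phi>\<close>

text \<open>
  The function \<open>F\<close> below has derivative \<open>- (\<Sum>i. c i * exp (- a i * t))\<^sup>2\<close> and tends to \<open>0\<close>, so its
  value at \<open>0\<close>, which is the kernel sum, is nonnegative.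
\<close>
lemma cauchy_kernel_nonneg:
  fixes a c :: "'i \<Rightarrow> real"
  assumes pos: "\<And>i. i \<in> I \<Longrightarrow> 0 < a i"
  shows "0 \<le> (\<Sum>i\<in>I. \<Sum>j\<in>I. c i * c j / (a i + a j))"
proof -
  define F where "F t = (\<Sum>i\<in>I. \<Sum>j\<in>I. c i * c j / (a i + a j) * exp (- (a i + a j) * t))" for t
  have deriv: "(F has_real_derivative - ((\<Sum>i\<in>I. c i * exp (- a i * t))\<^sup>2)) (at t)" for t
  proof -
    have ne: "a i + a j \<noteq> 0" if "i \<in> I" "j \<in> I" for i j
      using pos[OF that(1)] pos[OF that(2)] by simp
    have "(F has_real_derivative
        (\<Sum>i\<in>I. \<Sum>j\<in>I. c i * c j / (a i + a j) * (exp (- (a i + a j) * t) * (- (a i + a j))))) (at t)"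
      unfolding F_def
    proof (intro DERIV_sum)
      fix i j
      show "((\<lambda>t. c i * c j / (a i + a j) * exp (- (a i + a j) * t)) has_real_derivative
          c i * c j / (a i + a j) * (exp (- (a i + a j) * t) * (- (a i + a j)))) (at t)"
        by (intro DERIV_cmult DERIV_fun_exp DERIV_cmult_Id)
    qed
    \<comment> \<open>Differentiation cancels the denominator \<open>a i + a j\<close>, and the
      exponential of the sum splits into a product; the double sum is then a product of two equal
      sums.\<close>
    also have "(\<Sum>i\<in>I. \<Sum>j\<in>I. c i * c j / (a i + a j) * (exp (- (a i + a j) * t) * (- (a i + a j))))
        = (\<Sum>i\<in>I. \<Sum>j\<in>I. - ((c i * exp (- a i * t)) * (c j * exp (- a j * t))))"
    proof (intro sum.cong refl)
      fix i j assume "i \<in> I" "j \<in> I"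
      have "exp (- (a i + a j) * t) = exp (- a i * t) * exp (- a j * t)"
        by (simp add: exp_add[symmetric] algebra_simps)
      then show "c i * c j / (a i + a j) * (exp (- (a i + a j) * t) * (- (a i + a j)))
          = - ((c i * exp (- a i * t)) * (c j * exp (- a j * t)))"
        using ne[OF \<open>i \<in> I\<close> \<open>j \<in> I\<close>] by (simp add: field_simps)
    qed
    also have "\<dots> = - ((\<Sum>i\<in>I. c i * exp (- a i * t))\<^sup>2)"
      by (simp add: power2_eq_square sum_product sum_negf)
    finally show ?thesis .
  qed
  \<comment> \<open>Each exponent has the negative rate \<open>- (a i + a j)\<close>, so every term
    vanishes at infinity. The limit is written as a double sum of zeros to match the termwise
    limits.\<close>
  have "(F \<longlongrightarrow> (\<Sum>i\<in>I. \<Sum>j\<in>I. 0)) at_top"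
    unfolding F_def
  proof (intro tendsto_sum)
    fix i j assume "i \<in> I" "j \<in> I"
    then have "0 < a i + a j" using pos by (simp add: add_pos_pos)
    then have "filterlim (\<lambda>t. (a i + a j) * t) at_top at_top"
      by (intro filterlim_tendsto_pos_mult_at_top[OF tendsto_const] filterlim_ident)
    then have "((\<lambda>t. exp (- ((a i + a j) * t))) \<longlongrightarrow> 0) at_top"
      by (intro filterlim_compose[OF exp_at_bot]) (simp add: filterlim_uminus_at_top[symmetric])
    from tendsto_mult_right_zero[OF this, of "c i * c j / (a i + a j)"]
    show "((\<lambda>t. c i * c j / (a i + a j) * exp (- (a i + a j) * t)) \<longlongrightarrow> 0) at_top"
      by (simp add: algebra_simps)
  qed
  then have lim: "(F \<longlongrightarrow> 0) at_top" by simp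
  have "F t \<le> F 0" if "0 \<le> t" for t
  proof (rule DERIV_nonpos_imp_nonincreasing[OF that])
    fix x
    show "\<exists>y. (F has_real_derivative y) (at x) \<and> y \<le> 0"
      using deriv[of x] by (intro exI conjI) auto
  qed
  then have "\<forall>\<^sub>F t in at_top. F t \<le> F 0"
    by (rule eventually_at_top_linorderI)
  then have "0 \<le> F 0"
    by (rule tendsto_upperbound[OF lim]) simp
  then show ?thesis by (simp add: F_def)
qed

text \<open>Moving \<open>P\<close> across the scalar product turns the form at \<open>v\<close>
  into the form of \<open>W\<close> at \<open>transpose_mat P *\<^sub>v v\<close>. The matrix
  \<open>P\<close> may be rectangular and of any rank.\<close>

lemma symmetric_psd_congruence:
  assumes W: "symmetric_psd k W" and P: "P \<in> carrier_mat n k"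
  shows "symmetric_psd n (P * W * transpose_mat P)"
proof -
  have Wc: "W \<in> carrier_mat k k" and Wt: "transpose_mat W = W"
    and Wp: "\<And>v. v \<in> carrier_vec k \<Longrightarrow> 0 \<le> v \<bullet> (W *\<^sub>v v)"
    using W by (auto simp: symmetric_psd_def)
  have Pt: "transpose_mat P \<in> carrier_mat k n" using P by simp
  have PW: "P * W \<in> carrier_mat n k" using P Wc by simp
  have "transpose_mat (P * W * transpose_mat P) = P * (W * transpose_mat P)"
    unfolding transpose_mult[OF PW Pt] transpose_mult[OF P Wc] by (simp add: Wt)
  also have "\<dots> = P * W * transpose_mat P"
    by (rule assoc_mult_mat[OF P Wc Pt, symmetric])
  finally have "transpose_mat (P * W * transpose_mat P) = P * W * transpose_mat P" .
  moreover have "0 \<le> v \<bullet> ((P * W * transpose_mat P) *\<^sub>v v)" if v: "v \<in> carrier_vec n" for v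
  proof -
    let ?u = "transpose_mat P *\<^sub>v v"
    have u: "?u \<in> carrier_vec k" using Pt v by simp
    have "(P * W * transpose_mat P) *\<^sub>v v = P *\<^sub>v (W *\<^sub>v ?u)"
      using P Wc Pt PW v u
      by (simp add: assoc_mult_mat_vec[of _ n k _ n] assoc_mult_mat_vec[of _ n k _ k])
    then have "v \<bullet> ((P * W * transpose_mat P) *\<^sub>v v) = ?u \<bullet> (W *\<^sub>v ?u)"
      using transpose_vec_mult_scalar[OF P _ v, of "W *\<^sub>v ?u"] Wc u by simp
    then show ?thesis using Wp[OF u] by simp
  qed
  ultimately show ?thesis using PW P by (simp add: symmetric_psd_def)
qed

text \<open>An instance of the Schur product theorem, obtained directly: expanding the Gram matrix
  over the columns \<open>l\<close> of \<open>N\<close> splits the form at \<open>v\<close> into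
  Cauchy kernel sums with \<open>a i = - lam i\<close> and coefficients
  \<open>c i = v $ i * N $$ (i, l)\<close>.\<close>

lemma symmetric_psd_hadamard_gram_cauchy:
  assumes N: "N \<in> carrier_mat k p" and neg: "\<And>i. i < k \<Longrightarrow> lam i < 0"
  shows "symmetric_psd k
    (hadamard (N * transpose_mat N) (mat k k (\<lambda>(i, j). - (1 / (lam i + lam j)))))"
    (is "symmetric_psd k ?W")
proof -
  have Wc: "?W \<in> carrier_mat k k" using N by (simp add: hadamard_def)
  have idx: "?W $$ (i, j) = (\<Sum>l<p. N $$ (i, l) * N $$ (j, l)) * (1 / (- lam i + - lam j))"
    if "i < k" "j < k" for i j
  proof -
    have "- (1 / (lam i + lam j)) = 1 / (- lam i + - lam j)"
      by (metis minus_add_distrib minus_divide_right)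
    then show ?thesis
      using that N by (simp add: hadamard_def scalar_prod_def lessThan_atLeast0)
  qed
  have "transpose_mat ?W = ?W"
  proof (rule eq_matI)
    fix i j assume "i < dim_row ?W" "j < dim_col ?W"
    then have ij: "i < k" "j < k" using Wc by auto
    then have "transpose_mat ?W $$ (i, j) = ?W $$ (j, i)" using Wc by simp
    also have "\<dots> = ?W $$ (i, j)"
      unfolding idx[OF ij] idx[OF ij(2,1)] by (simp add: mult.commute add.commute)
    finally show "transpose_mat ?W $$ (i, j) = ?W $$ (i, j)" .
  qed (use Wc in auto)
  moreover have "0 \<le> v \<bullet> (?W *\<^sub>v v)" if v: "v \<in> carrier_vec k" for v
  proof -
    have "v \<bullet> (?W *\<^sub>v v) = (\<Sum>i<k. \<Sum>j<k. v $ i * ?W $$ (i, j) * v $ j)"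
      by (rule quad_form_sum[OF Wc v v])
    also have "\<dots> = (\<Sum>i<k. \<Sum>j<k. \<Sum>l<p.
        (v $ i * N $$ (i, l)) * (v $ j * N $$ (j, l)) / (- lam i + - lam j))"
      by (intro sum.cong refl)
         (simp add: idx sum_distrib_left sum_distrib_right sum_divide_distrib mult_ac del: minus_add_distrib)
    \<comment> \<open>Two interchanges bring the sum over the columns of \<open>N\<close> outermost,
      so that the kernel inequality applies to each summand.\<close>
    also have "\<dots> = (\<Sum>i<k. \<Sum>l<p. \<Sum>j<k.
        (v $ i * N $$ (i, l)) * (v $ j * N $$ (j, l)) / (- lam i + - lam j))"
      by (intro sum.cong refl sum.swap)
    also have "\<dots> = (\<Sum>l<p. \<Sum>i<k. \<Sum>j<k.
        (v $ i * N $$ (i, l)) * (v $ j * N $$ (j, l)) / (- lam i + - lam j))"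
      by (rule sum.swap)
    also have "\<dots> \<ge> 0"
      by (intro sum_nonneg cauchy_kernel_nonneg) (use neg in auto)
    finally show ?thesis .
  qed
  ultimately show ?thesis using Wc by (simp add: symmetric_psd_def)
qed

text \<open>The first Hadamard factor is the Gram matrix of the rows of
  \<open>\<Omega> * B\<^sub>d\<close>, and the outer factors formed from the first
  \<open>\<kappa>\<close> columns of \<open>Y\<close> act as a congruence.\<close>

lemma symmetric_psd_Phi:
  assumes Bd: "B\<^sub>d \<in> carrier_mat n p" and neg: "\<And>i. i < \<kappa> \<Longrightarrow> lam i < 0"
  shows "symmetric_psd n (Phi n \<kappa> Y lam B\<^sub>d)"
proof -
  define P where "P = mat n \<kappa> (\<lambda>(i, j). Y $$ (i, j))"
  define \<Omega> where "\<Omega> = mat \<kappa> n (\<lambda>(i, j). mat_inv Y $$ (i, j))"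
  have \<Omega>: "\<Omega> \<in> carrier_mat \<kappa> n" by (simp add: \<Omega>_def)
  have "\<Omega> * B\<^sub>d * transpose_mat B\<^sub>d * transpose_mat \<Omega> = (\<Omega> * B\<^sub>d) * transpose_mat (\<Omega> * B\<^sub>d)"
    unfolding transpose_mult[OF \<Omega> Bd]
    by (rule assoc_mult_mat) (use \<Omega> Bd in auto)
  then have "Phi n \<kappa> Y lam B\<^sub>d = P * hadamard ((\<Omega> * B\<^sub>d) * transpose_mat (\<Omega> * B\<^sub>d))
      (mat \<kappa> \<kappa> (\<lambda>(i, j). - (1 / (lam i + lam j)))) * transpose_mat P"
    by (simp add: Phi_def Let_def P_def \<Omega>_def)
  moreover have "\<Omega> * B\<^sub>d \<in> carrier_mat \<kappa> p" using \<Omega> Bd by simp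
  ultimately show ?thesis
    by (auto intro!: symmetric_psd_congruence symmetric_psd_hadamard_gram_cauchy neg simp: P_def)
qed

section \<open>The Rayleigh supremum as an eigenvalue\<close>

text \<open>Each product of two coordinates is at most \<open>w \<bullet> w\<close> in absolute
  value, so the sum of the absolute entries serves as a constant. It is applied to the symmetric
  matrix itself, to make the supremum finite, and to an inverse, whose symmetry is then not at
  issue.\<close>

lemma quad_form_bound:
  fixes M :: "real mat"
  assumes M: "M \<in> carrier_mat k k"
  obtains C where "0 < C" "\<And>w. w \<in> carrier_vec k \<Longrightarrow> w \<bullet> (M *\<^sub>v w) \<le> C * (w \<bullet> w)"
proof
  \<comment> \<open>The summand 1 keeps the constant strictly positive even for the zero
    matrix.\<close>
  let ?C = "(\<Sum>i<k. \<Sum>j<k. \<bar>M $$ (i, j)\<bar>) + 1"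
  show "0 < ?C" by (intro add_nonneg_pos sum_nonneg) auto
  fix w :: "real vec" assume w: "w \<in> carrier_vec k"
  have sq: "(w $ i)\<^sup>2 \<le> w \<bullet> w" if "i < k" for i
    using w that member_le_sum[of i "{0..<k}" "\<lambda>i. (w $ i)\<^sup>2"]
    by (auto simp: scalar_prod_def power2_eq_square)
  have "w \<bullet> (M *\<^sub>v w) = (\<Sum>i<k. \<Sum>j<k. w $ i * M $$ (i, j) * w $ j)"
    by (rule quad_form_sum[OF M w w])
  also have "\<dots> \<le> (\<Sum>i<k. \<Sum>j<k. \<bar>M $$ (i, j)\<bar> * (w \<bullet> w))"
  proof (intro sum_mono)
    fix i j assume "i \<in> {..<k}" "j \<in> {..<k}"
    then have "(w $ i)\<^sup>2 \<le> w \<bullet> w" "(w $ j)\<^sup>2 \<le> w \<bullet> w" using sq by auto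
    moreover have "2 * \<bar>w $ i * w $ j\<bar> \<le> (w $ i)\<^sup>2 + (w $ j)\<^sup>2"
      using sum_squares_bound[of "\<bar>w $ i\<bar>" "\<bar>w $ j\<bar>"] by (simp add: abs_mult)
    ultimately have b: "\<bar>w $ i * w $ j\<bar> \<le> w \<bullet> w" by linarith
    have "w $ i * M $$ (i, j) * w $ j \<le> \<bar>M $$ (i, j)\<bar> * \<bar>w $ i * w $ j\<bar>"
      using abs_ge_self[of "w $ i * M $$ (i, j) * w $ j"] by (simp add: abs_mult mult_ac)
    also have "\<dots> \<le> \<bar>M $$ (i, j)\<bar> * (w \<bullet> w)" by (rule mult_left_mono[OF b]) simp
    finally show "w $ i * M $$ (i, j) * w $ j \<le> \<bar>M $$ (i, j)\<bar> * (w \<bullet> w)" .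
  qed
  also have "\<dots> \<le> ?C * (w \<bullet> w)"
    using scalar_prod_self_nonneg[of w] by (simp add: sum_distrib_right distrib_right)
  finally show "w \<bullet> (M *\<^sub>v w) \<le> ?C * (w \<bullet> w)" .
qed

text \<open>The form at \<open>u + t \<cdot>\<^sub>v v\<close> is a quadratic polynomial in
  \<open>t\<close> that is never negative. Since the form is only semidefinite, its leading
  coefficient \<open>c\<close> may vanish even for nonzero \<open>v\<close>.\<close>

lemma symmetric_psd_cauchy_schwarz:
  assumes A: "symmetric_psd n A" and u: "u \<in> carrier_vec n" and v: "v \<in> carrier_vec n"
  shows "(u \<bullet> (A *\<^sub>v v))\<^sup>2 \<le> (u \<bullet> (A *\<^sub>v u)) * (v \<bullet> (A *\<^sub>v v))"
proof -
  define a b c where "a = u \<bullet> (A *\<^sub>v u)" "b = u \<bullet> (A *\<^sub>v v)" "c = v \<bullet> (A *\<^sub>v v)"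
  note abc = this
  have Ac: "A \<in> carrier_mat n n" and At: "transpose_mat A = A"
    and Ap: "\<And>v. v \<in> carrier_vec n \<Longrightarrow> 0 \<le> v \<bullet> (A *\<^sub>v v)"
    using A by (auto simp: symmetric_psd_def)
  have sym: "v \<bullet> (A *\<^sub>v u) = b"
    using symmetric_form_commute[OF Ac At v u] by (simp add: abc)
  have q: "0 \<le> a + 2 * b * t + c * t\<^sup>2" for t
  proof -
    have tv: "t \<cdot>\<^sub>v v \<in> carrier_vec n" and Au: "A *\<^sub>v u \<in> carrier_vec n"
      and Av: "A *\<^sub>v v \<in> carrier_vec n" and tAv: "t \<cdot>\<^sub>v (A *\<^sub>v v) \<in> carrier_vec n"
      using u v Ac by auto
    have "A *\<^sub>v (u + t \<cdot>\<^sub>v v) = A *\<^sub>v u + t \<cdot>\<^sub>v (A *\<^sub>v v)"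
      using Ac u v tv by (simp add: mult_add_distrib_mat_vec mult_mat_vec)
    then have "(u + t \<cdot>\<^sub>v v) \<bullet> (A *\<^sub>v (u + t \<cdot>\<^sub>v v)) = a + t * b + (t * b + t * (t * c))"
      using u v tv Au Av tAv sym
      by (simp add: add_scalar_prod_distrib[of _ n] scalar_prod_add_distrib[of _ n] abc algebra_simps)
    moreover have "u + t \<cdot>\<^sub>v v \<in> carrier_vec n" using u tv by simp
    ultimately show ?thesis
      using Ap[of "u + t \<cdot>\<^sub>v v"] by (simp add: power2_eq_square algebra_simps)
  qed
  have "b\<^sup>2 \<le> a * c"
  proof (cases "c = 0")
    case True
    have "b = 0"
    proof (rule ccontr)
      assume "b \<noteq> 0"
      \<comment> \<open>With \<open>c = 0\<close> the polynomial is affine, and this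
        \<open>t\<close> gives it the value -1.\<close>
      with True q[of "- (a + 1) / (2 * b)"] show False by simp
    qed
    with True show ?thesis by simp
  next
    case False
    then have "0 < c" using Ap[OF v] by (simp add: abc)
    \<comment> \<open>The minimum of the quadratic lies at \<open>t = - b / c\<close> and has the
      value \<open>a - b\<^sup>2 / c\<close>.\<close>
    with q[of "- b / c"] show ?thesis
      by (simp add: field_simps power2_eq_square)
  qed
  then show ?thesis by (simp add: abc)
qed

text \<open>
  With \<open>A * B = 1\<close>, Cauchy-Schwarz for the form of \<open>A\<close>, applied to \<open>w\<close> and \<open>B w\<close>, bounds
  \<open>(w \<bullet> w)\<^sup>2\<close> by \<open>w \<bullet> A w\<close> times \<open>B w \<bullet> w\<close>.
\<close>
lemma symmetric_psd_nonsingular_bound: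
  assumes A: "symmetric_psd n A" and det: "det A \<noteq> 0"
  obtains C where "0 < C" "\<And>w. w \<in> carrier_vec n \<Longrightarrow> w \<bullet> w \<le> C * (w \<bullet> (A *\<^sub>v w))"
proof -
  have Ac: "A \<in> carrier_mat n n"
    and Ap: "\<And>v. v \<in> carrier_vec n \<Longrightarrow> 0 \<le> v \<bullet> (A *\<^sub>v v)"
    using A by (auto simp: symmetric_psd_def)
  obtain B where B: "B \<in> carrier_mat n n" and AB: "A * B = 1\<^sub>m n"
    using det_non_zero_imp_unit[OF Ac det, unfolded Units_def ring_mat_def] by auto
  obtain C where C: "0 < C" "\<And>w. w \<in> carrier_vec n \<Longrightarrow> w \<bullet> (B *\<^sub>v w) \<le> C * (w \<bullet> w)"
    using quad_form_bound[OF B] by blast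
  have "w \<bullet> w \<le> C * (w \<bullet> (A *\<^sub>v w))" if w: "w \<in> carrier_vec n" for w
  \<comment> \<open>The main case ends by cancelling a factor \<open>w \<bullet> w\<close>, so its
    vanishing is treated apart.\<close>
  proof (cases "w \<bullet> w = 0")
    case True
    then show ?thesis using C(1) Ap[OF w] by simp
  next
    case False
    then have ww: "0 < w \<bullet> w" using scalar_prod_self_nonneg[of w] by simp
    let ?u = "B *\<^sub>v w"
    have u: "?u \<in> carrier_vec n" using B w by simp
    have Au: "A *\<^sub>v ?u = w"
      using assoc_mult_mat_vec[OF Ac B w] AB w by simp
    have "(w \<bullet> w)\<^sup>2 \<le> (w \<bullet> (A *\<^sub>v w)) * (w \<bullet> ?u)"
      using symmetric_psd_cauchy_schwarz[OF A w u] comm_scalar_prod[OF u w] by (simp add: Au)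
    also have "\<dots> \<le> (w \<bullet> (A *\<^sub>v w)) * (C * (w \<bullet> w))"
      by (rule mult_left_mono[OF C(2)[OF w] Ap[OF w]])
    finally show ?thesis using ww by (simp add: power2_eq_square mult_ac)
  qed
  with C(1) that show ?thesis by blast
qed

lemma symmetric_rayleigh_max:
  fixes M :: "real mat"
  assumes M: "M \<in> carrier_mat k k" and sym: "transpose_mat M = M" and k: "0 < k"
  obtains s where "eigenvalue M s" "\<And>w. w \<in> carrier_vec k \<Longrightarrow> w \<bullet> (M *\<^sub>v w) \<le> s * (w \<bullet> w)"
proof -
  define S where "S = (\<lambda>w. w \<bullet> (M *\<^sub>v w)) ` {w \<in> carrier_vec k. w \<bullet> w = 1}"
  define s where "s = Sup S"
  obtain C where C: "0 < C" "\<And>w. w \<in> carrier_vec k \<Longrightarrow> w \<bullet> (M *\<^sub>v w) \<le> C * (w \<bullet> w)"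
    using quad_form_bound[OF M] by blast
  have bdd: "bdd_above S" unfolding S_def by (rule bdd_aboveI2[where M = C]) (use C(2) in force)
  \<comment> \<open>A positive dimension provides a unit vector; without one the supremum would
    carry no information.\<close>
  have ne: "S \<noteq> {}"
    using k by (auto simp: S_def intro!: exI[of _ "unit_vec k 0"])
  have le: "w \<bullet> (M *\<^sub>v w) \<le> s * (w \<bullet> w)" if w: "w \<in> carrier_vec k" for w
  proof (cases "w \<bullet> w = 0")
    case True
    then have "w = 0\<^sub>v k" using scalar_prod_self_eq_0_iff[OF w] by simp
    then show ?thesis using M by simp
  next
    case False
    then have ww: "0 < w \<bullet> w" using scalar_prod_self_nonneg[of w] by simp
    \<comment> \<open>Scaling by \<open>c\<close> puts \<open>w\<close> on the unit sphere. Both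
      sides of the bound are homogeneous of degree two, so the bound there carries over to
      \<open>w\<close>.\<close>
    define c where "c = 1 / sqrt (w \<bullet> w)"
    have c: "c * c * (w \<bullet> w) = 1" using ww by (simp add: c_def)
    have "(c \<cdot>\<^sub>v w) \<bullet> (c \<cdot>\<^sub>v w) = 1" using w c by (simp add: mult.assoc)
    then have "(c \<cdot>\<^sub>v w) \<bullet> (M *\<^sub>v (c \<cdot>\<^sub>v w)) \<in> S" using w by (auto simp: S_def)
    then have "(c \<cdot>\<^sub>v w) \<bullet> (M *\<^sub>v (c \<cdot>\<^sub>v w)) \<le> s" unfolding s_def using bdd by (rule cSup_upper)
    moreover have "(c \<cdot>\<^sub>v w) \<bullet> (M *\<^sub>v (c \<cdot>\<^sub>v w)) = c * c * (w \<bullet> (M *\<^sub>v w))"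
      using w M by (simp add: mult_mat_vec[OF M w] mult.assoc)
    ultimately have "c * c * (w \<bullet> (M *\<^sub>v w)) * (w \<bullet> w) \<le> s * (w \<bullet> w)"
      using ww by (simp add: mult_right_mono)
    moreover have "c * c * (w \<bullet> (M *\<^sub>v w)) * (w \<bullet> w) = w \<bullet> (M *\<^sub>v w)"
      using c by (metis mult.assoc mult.commute mult_1)
    ultimately show ?thesis by simp
  qed
  define A where "A = s \<cdot>\<^sub>m 1\<^sub>m k - M"
  have Ac: "A \<in> carrier_mat k k" using minus_carrier_mat[OF M] by (simp add: A_def)
  have Av: "A *\<^sub>v w = s \<cdot>\<^sub>v w - M *\<^sub>v w" if "w \<in> carrier_vec k" for w
    proof -
    have "(s \<cdot>\<^sub>m 1\<^sub>m k) *\<^sub>v w = s \<cdot>\<^sub>v w"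
      using that by (intro eq_vecI) (auto simp: smult_scalar_prod_distrib[of _ k])
    then show ?thesis using M that by (simp add: A_def minus_mult_distrib_mat_vec[of _ k k])
  qed
  have Aq: "w \<bullet> (A *\<^sub>v w) = s * (w \<bullet> w) - w \<bullet> (M *\<^sub>v w)" if w: "w \<in> carrier_vec k" for w
    using w M by (simp add: Av[OF w] scalar_prod_minus_distrib[of _ k])
  have "transpose_mat A = A"
    using M sym by (intro eq_matI) (auto simp: A_def transpose_minus[of _ k k])
  then have psd: "symmetric_psd k A"
    using Ac Aq le by (simp add: symmetric_psd_def)
  have "det A = 0"
  proof (rule ccontr)
    assume "det A \<noteq> 0"
    from symmetric_psd_nonsingular_bound[OF psd this]
    obtain D where D: "0 < D" "\<And>w. w \<in> carrier_vec k \<Longrightarrow> w \<bullet> w \<le> D * (w \<bullet> (A *\<^sub>v w))" by blast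
    \<comment> \<open>For a unit vector with value \<open>x\<close> the lower bound reads
      \<open>1 \<le> D * (s - x)\<close>. Hence \<open>s - 1 / D\<close> already bounds
      \<open>S\<close> from above, although \<open>s\<close> is its least upper bound.\<close>
    have "s \<le> s - 1 / D"
    proof (subst (1) s_def, rule cSup_least[OF ne])
      fix x assume "x \<in> S"
      then obtain w where w: "w \<in> carrier_vec k" "w \<bullet> w = 1" and x: "x = w \<bullet> (M *\<^sub>v w)"
        by (auto simp: S_def)
      have "1 \<le> D * (s - x)" using D(2)[OF w(1)] Aq[OF w(1)] w(2) x by simp
      then show "x \<le> s - 1 / D" using D(1) by (simp add: field_simps)
    qed
    with D(1) show False by simp
  qed
  then obtain v where v: "v \<in> carrier_vec k" "v \<noteq> 0\<^sub>v k" "A *\<^sub>v v = 0\<^sub>v k"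
    using det_0_iff_vec_prod_zero_field[OF Ac] by blast
  have "M *\<^sub>v v = s \<cdot>\<^sub>v v"
  proof (rule eq_vecI)
    fix i assume "i < dim_vec (s \<cdot>\<^sub>v v)"
    then have i: "i < k" using v by simp
    have "(s \<cdot>\<^sub>v v - M *\<^sub>v v) $ i = 0" using v Av[OF v(1)] i by simp
    then show "(M *\<^sub>v v) $ i = (s \<cdot>\<^sub>v v) $ i" using i v M by simp
  qed (use v M in auto)
  then have "eigenvalue M s" using v M by (auto simp: eigenvalue_def eigenvector_def)
  then show ?thesis using that le by blast
qed

section \<open>Rightmost eigenvectors of real symmetric matrices\<close>

text \<open>The real part of \<open>z\<^sup>* M z\<close> is \<open>x \<bullet> M x + y \<bullet> M y\<close> for \<open>z = x + \<i> y\<close>.\<close>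
lemma complex_eigenvalue_le_rayleigh_bound:
  fixes M :: "real mat"
  assumes M: "M \<in> carrier_mat k k" and sym: "transpose_mat M = M"
    and bound: "\<And>w. w \<in> carrier_vec k \<Longrightarrow> w \<bullet> (M *\<^sub>v w) \<le> s * (w \<bullet> w)"
    and ev: "eigenvalue (complexify M) \<nu>"
  shows "Re \<nu> \<le> s"
proof -
  obtain z where z: "z \<in> carrier_vec k" "z \<noteq> 0\<^sub>v k" "complexify M *\<^sub>v z = \<nu> \<cdot>\<^sub>v z"
    using ev M by (auto simp: eigenvalue_def eigenvector_def)
  define x where "x = map_vec Re z"
  define y where "y = map_vec Im z"
  have xy: "x \<in> carrier_vec k" "y \<in> carrier_vec k" using z by (auto simp: x_def y_def)
  have comp: "(complexify M *\<^sub>v z) $ i = \<nu> * z $ i" if "i < k" for i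
    using z that by simp
  have Mx: "M *\<^sub>v x = Re \<nu> \<cdot>\<^sub>v x - Im \<nu> \<cdot>\<^sub>v y"
  proof (rule eq_vecI)
    fix i assume "i < dim_vec (Re \<nu> \<cdot>\<^sub>v x - Im \<nu> \<cdot>\<^sub>v y)"
    then have i: "i < k" using xy by simp
    from arg_cong[OF comp[OF i], of Re]
    show "(M *\<^sub>v x) $ i = (Re \<nu> \<cdot>\<^sub>v x - Im \<nu> \<cdot>\<^sub>v y) $ i"
      using M z(1) i by (simp add: scalar_prod_def x_def y_def)
  qed (use M xy in auto)
  have My: "M *\<^sub>v y = Re \<nu> \<cdot>\<^sub>v y + Im \<nu> \<cdot>\<^sub>v x"
  proof (rule eq_vecI)
    fix i assume "i < dim_vec (Re \<nu> \<cdot>\<^sub>v y + Im \<nu> \<cdot>\<^sub>v x)"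
    then have i: "i < k" using xy by simp
    from arg_cong[OF comp[OF i], of Im]
    show "(M *\<^sub>v y) $ i = (Re \<nu> \<cdot>\<^sub>v y + Im \<nu> \<cdot>\<^sub>v x) $ i"
      using M z(1) i by (simp add: scalar_prod_def x_def y_def)
  qed (use M xy in auto)
  \<comment> \<open>The cross terms with \<open>Im \<nu>\<close> are \<open>x \<bullet> y\<close>
    and \<open>y \<bullet> x\<close> with opposite signs, and cancel.\<close>
  have "x \<bullet> (M *\<^sub>v x) + y \<bullet> (M *\<^sub>v y) = Re \<nu> * (x \<bullet> x + y \<bullet> y)"
    using xy comm_scalar_prod[OF xy]
    by (simp add: Mx My scalar_prod_minus_distrib[of _ k] scalar_prod_add_distrib[of _ k] algebra_simps)
  then have le: "Re \<nu> * (x \<bullet> x + y \<bullet> y) \<le> s * (x \<bullet> x + y \<bullet> y)"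
    using bound[OF xy(1)] bound[OF xy(2)] by (simp add: algebra_simps)
  have "x \<noteq> 0\<^sub>v k \<or> y \<noteq> 0\<^sub>v k"
  proof (rule ccontr)
    assume "\<not> ?thesis"
    then have "x = 0\<^sub>v k" "y = 0\<^sub>v k" by auto
    then have "z $ i = 0" if "i < k" for i
      using that z(1) by (metis x_def y_def carrier_vecD complex_eq_iff index_map_vec(1)
          index_zero_vec(1) zero_complex.sel)
    then have "z = 0\<^sub>v k" using z(1) by (intro eq_vecI) auto
    with z(2) show False by simp
  qed
  then have "0 < x \<bullet> x + y \<bullet> y"
    using scalar_prod_self_eq_0_iff[OF xy(1)] scalar_prod_self_eq_0_iff[OF xy(2)]
      scalar_prod_self_nonneg[of x] scalar_prod_self_nonneg[of y] by linarith
  with le show ?thesis by (simp add: mult_le_cancel_right)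
qed

text \<open>The eigenvalue attached to a rightmost eigenvector is a priori complex. At a nonzero
  coordinate of a real eigenvector, comparing imaginary parts forces it to be real, which returns
  the problem to \<open>M\<close> itself.\<close>

lemma eigenvector_complexify_iff:
  fixes M :: "real mat"
  assumes M: "M \<in> carrier_mat k k"
  shows "eigenvector (complexify M) (map_vec complex_of_real v) \<mu> \<longleftrightarrow>
    eigenvector M v (Re \<mu>) \<and> \<mu> \<in> \<real>"
proof -
  have zero: "map_vec complex_of_real v = 0\<^sub>v k \<longleftrightarrow> v = 0\<^sub>v k" if "v \<in> carrier_vec k"
    using that by (auto simp: vec_eq_iff)
  have mv: "complexify M *\<^sub>v map_vec complex_of_real v = map_vec complex_of_real (M *\<^sub>v v)"
    if "v \<in> carrier_vec k"
    using M that by (auto simp: scalar_prod_def intro!: eq_vecI)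
  have eq: "map_vec complex_of_real (M *\<^sub>v v) = \<mu> \<cdot>\<^sub>v map_vec complex_of_real v \<longleftrightarrow>
      M *\<^sub>v v = Re \<mu> \<cdot>\<^sub>v v \<and> \<mu> \<in> \<real>" if v: "v \<in> carrier_vec k" "v \<noteq> 0\<^sub>v k"
  proof
    assume L: "map_vec complex_of_real (M *\<^sub>v v) = \<mu> \<cdot>\<^sub>v map_vec complex_of_real v"
    have c: "complex_of_real ((M *\<^sub>v v) $ i) = \<mu> * complex_of_real (v $ i)" if "i < k" for i
      using arg_cong[OF L, of "\<lambda>u. u $ i"] that M v by simp
    obtain i where i: "i < k" "v $ i \<noteq> 0" using v by (auto simp: vec_eq_iff)
    have "Im \<mu> = 0" using arg_cong[OF c[OF i(1)], of Im] i by simp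
    moreover have "M *\<^sub>v v = Re \<mu> \<cdot>\<^sub>v v"
    proof (rule eq_vecI)
      fix j assume "j < dim_vec (Re \<mu> \<cdot>\<^sub>v v)"
      then have "j < k" using v by simp
      from arg_cong[OF c[OF this], of Re] this v
      show "(M *\<^sub>v v) $ j = (Re \<mu> \<cdot>\<^sub>v v) $ j" by simp
    qed (use M v in auto)
    ultimately show "M *\<^sub>v v = Re \<mu> \<cdot>\<^sub>v v \<and> \<mu> \<in> \<real>" by (simp add: complex_is_Real_iff)
  next
    assume R: "M *\<^sub>v v = Re \<mu> \<cdot>\<^sub>v v \<and> \<mu> \<in> \<real>"
    then have "complex_of_real (Re \<mu>) = \<mu>" by simp
    then show "map_vec complex_of_real (M *\<^sub>v v) = \<mu> \<cdot>\<^sub>v map_vec complex_of_real v"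
      using R M v by (auto intro!: eq_vecI)
  qed
  show ?thesis using M zero mv eq by (auto simp: eigenvector_def)
qed

text \<open>The Rayleigh bound \<open>s\<close> is at once the largest real eigenvalue and the
  largest real part of a complex one. A rightmost eigenvector therefore belongs to \<open>s\<close>,
  and at unit norm its form takes the value \<open>s\<close>, which no other unit vector
  exceeds.\<close>

lemma symmetric_rightmost_eigenvector_rayleigh:
  fixes M :: "real mat"
  assumes M: "M \<in> carrier_mat k k" and sym: "transpose_mat M = M" and k: "0 < k"
  shows "\<exists>v. rightmost_eigenvector M v \<and> norm2 v = 1"
    and "rightmost_eigenvector M v \<Longrightarrow> norm2 v = 1 \<Longrightarrow>
      eigenvector M v (Max (spectrum M)) \<and>
      is_arg_max (\<lambda>w. w \<bullet> (M *\<^sub>v w)) (\<lambda>w. w \<in> carrier_vec k \<and> norm2 w = 1) v"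
proof -
  obtain s where s: "eigenvalue M s"
    and bound: "\<And>w. w \<in> carrier_vec k \<Longrightarrow> w \<bullet> (M *\<^sub>v w) \<le> s * (w \<bullet> w)"
    using symmetric_rayleigh_max[OF M sym k] by blast
  have re: "Re \<nu> \<le> s" if "eigenvalue (complexify M) \<nu>" for \<nu>
    by (rule complex_eigenvalue_le_rayleigh_bound[OF M sym bound that])
  have lift: "eigenvector (complexify M) (map_vec complex_of_real v) (complex_of_real t)"
    if "eigenvector M v t" for v t
    using that eigenvector_complexify_iff[OF M] by simp
  have Max_s: "Max (spectrum M) = s"
  proof (rule Max_eqI)
    show "finite (spectrum M)" using card_finite_spectrum(1)[OF M] .
    show "s \<in> spectrum M" using s by (simp add: spectrum_def)
    fix t assume "t \<in> spectrum M"
    then have "eigenvalue (complexify M) (complex_of_real t)"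
      using lift by (auto simp: spectrum_def eigenvalue_def)
    from re[OF this] show "t \<le> s" by simp
  qed
  show "\<exists>v. rightmost_eigenvector M v \<and> norm2 v = 1"
  proof -
    obtain v where v: "v \<in> carrier_vec k" "v \<noteq> 0\<^sub>v k" "M *\<^sub>v v = s \<cdot>\<^sub>v v"
      using s M by (auto simp: eigenvalue_def eigenvector_def)
    define c where "c = 1 / sqrt (v \<bullet> v)"
    have vv: "0 < v \<bullet> v"
      using scalar_prod_self_eq_0_iff[OF v(1)] scalar_prod_self_nonneg[of v] v(2) by linarith
    have n: "norm2 (c \<cdot>\<^sub>v v) = 1" using v(1) vv by (simp add: norm2_def c_def real_sqrt_divide)
    \<comment> \<open>The zero vector has norm 0, not 1.\<close>
    have "c \<cdot>\<^sub>v v \<noteq> 0\<^sub>v k"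
    proof
      assume "c \<cdot>\<^sub>v v = 0\<^sub>v k"
      with n show False by (simp add: norm2_def)
    qed
    then have "eigenvector M (c \<cdot>\<^sub>v v) s"
      using v M by (simp add: eigenvector_def mult_mat_vec[OF M v(1)] smult_smult_assoc mult.commute)
    from lift[OF this] have "rightmost_eigenvector M (c \<cdot>\<^sub>v v)"
      unfolding rightmost_eigenvector_def using re by force
    with n show ?thesis by blast
  qed
  assume "rightmost_eigenvector M v" and n: "norm2 v = 1"
  then obtain \<mu> where \<mu>: "eigenvector (complexify M) (map_vec complex_of_real v) \<mu>"
    and mx: "\<And>\<nu>. eigenvalue (complexify M) \<nu> \<Longrightarrow> Re \<nu> \<le> Re \<mu>"
    by (auto simp: rightmost_eigenvector_def)
  have "Re \<mu> \<le> s" using re \<mu> by (auto simp: eigenvalue_def)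
  \<comment> \<open>Viewed as a complex number, \<open>s\<close> is an eigenvalue of
    \<open>complexify M\<close> and hence competes in the maximality of
    \<open>\<mu>\<close>.\<close>
  moreover have "s \<le> Re \<mu>" using mx[of "complex_of_real s"] s lift by (auto simp: eigenvalue_def)
  ultimately have v: "eigenvector M v s" using eigenvector_complexify_iff[OF M] \<mu> by simp
  then have vc: "v \<in> carrier_vec k" and Mv: "M *\<^sub>v v = s \<cdot>\<^sub>v v"
    using M by (auto simp: eigenvector_def)
  have "v \<bullet> (M *\<^sub>v v) = s" using n vc by (simp add: Mv norm2_def)
  moreover have "w \<bullet> (M *\<^sub>v w) \<le> s" if "w \<in> carrier_vec k" "norm2 w = 1" for w
    using bound[OF that(1)] that(2) by (simp add: norm2_def)
  ultimately have "is_arg_max (\<lambda>w. w \<bullet> (M *\<^sub>v w)) (\<lambda>w. w \<in> carrier_vec k \<and> norm2 w = 1) v"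
    using vc n by (auto simp: is_arg_max_def not_less)
  with v Max_s show "eigenvector M v (Max (spectrum M)) \<and>
      is_arg_max (\<lambda>w. w \<bullet> (M *\<^sub>v w)) (\<lambda>w. w \<in> carrier_vec k \<and> norm2 w = 1) v" by simp
qed

section \<open>Principal submatrices and the blocks of the partition\<close>

text \<open>Row and column positions are translated by the same map \<open>pick J\<close> into
  indices below \<open>n\<close>, so symmetry of \<open>M\<close> passes to the submatrix entry by
  entry.\<close>

lemma principal_submatrix_symmetric:
  assumes M: "M \<in> carrier_mat n n" and sym: "transpose_mat M = M" and J: "J \<subseteq> {..<n}"
  shows "principal_submatrix M J \<in> carrier_mat (card J) (card J)"
    and "transpose_mat (principal_submatrix M J) = principal_submatrix M J"
proof -
  have J': "{i. i < n \<and> i \<in> J} = J" using J by auto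
  show c: "principal_submatrix M J \<in> carrier_mat (card J) (card J)"
  proof (rule carrier_matI)
    show "dim_row (principal_submatrix M J) = card J" "dim_col (principal_submatrix M J) = card J"
      unfolding dim_submatrix carrier_matD[OF M] J' by (rule refl)+
  qed
  have pick: "pick J i < n" if "i < card J" for i
    using pick_in_set_le[OF that] J by auto
  have entry: "M $$ (a, b) = M $$ (b, a)" if "a < n" "b < n" for a b
    using that M arg_cong[OF sym, of "\<lambda>M. M $$ (b, a)"] by simp
  show "transpose_mat (principal_submatrix M J) = principal_submatrix M J"
  proof (rule eq_matI)
    fix i j
    assume "i < dim_row (principal_submatrix M J)" "j < dim_col (principal_submatrix M J)"
    then have ij: "i < card J" "j < card J" using c by auto
    then show "transpose_mat (principal_submatrix M J) $$ (i, j) = principal_submatrix M J $$ (i, j)"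
      using M c entry[OF pick[OF ij(2)] pick[OF ij(1)]] by (simp add: submatrix_index J')
  qed (use c in auto)
qed

theorem theoremV1:
  fixes n m n\<^sub>b \<kappa> r :: nat
    and A B B\<^sub>d Q R G X Y Z H Q\<^sub>h R\<^sub>h :: "real mat"
    and lam :: "nat \<Rightarrow> real"
    and \<I> :: "nat \<Rightarrow> nat set"
  assumes A: "A \<in> carrier_mat n n"
    and B: "B \<in> carrier_mat n m"
    and Bd: "B\<^sub>d \<in> carrier_mat n n\<^sub>b"
    and Q: "symmetric_psd n Q"
    and R: "symmetric_pd m R"
    and Qh: "sqrt_factor n Q Q\<^sub>h"
    and Rh: "sqrt_factor m R R\<^sub>h"
    and G: "G = B * mat_inv R * transpose_mat B"
    and obs: "observable n (transpose_mat Q\<^sub>h) A"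
    and stab: "stabilizable n m A (B * mat_inv R\<^sub>h)"
    and ctrl: "controllable n n\<^sub>b A B\<^sub>d"
    and X: "symmetric_pd n X" "stabilizing_solution n A G Q X"
    and X_unique: "\<And>X'. stabilizing_solution n A G Q X' \<Longrightarrow> X' = X"
    and H: "H = hamiltonian A G Q"
    and H_diag: "diagonalizable (complexify H)"
    and Y: "Y \<in> carrier_mat n n" "invertible_mat Y"
    and Z: "Z \<in> carrier_mat n n"
    and YZ_span: "vec_space.col_space (2 * n) (Y @\<^sub>r Z) = stable_subspace (2 * n) H"
    and YZ_eig: "H * (Y @\<^sub>r Z) = (Y @\<^sub>r Z) * mat_diag n lam"
    and lam_neg: "\<And>i. i < n \<Longrightarrow> lam i < 0"
    and lam_decr: "\<And>i j. i < j \<Longrightarrow> j < n \<Longrightarrow> lam j < lam i"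
    and kappa: "\<kappa> < n"
    and A_hurwitz: "hurwitz A"
    and part: "partition_on {..<n} (\<I> ` {1..r})" "inj_on \<I> {1..r}"
  shows "symmetric_psd n (Phi n \<kappa> Y lam B\<^sub>d) \<and>
    (\<forall>i \<in> {1..r}.
       let M = principal_submatrix (Phi n \<kappa> Y lam B\<^sub>d) (\<I> i) in
       (\<exists>v. rightmost_eigenvector M v \<and> norm2 v = 1) \<and>
       (\<forall>v. rightmost_eigenvector M v \<and> norm2 v = 1 \<longrightarrow>
          eigenvector M v (Max (spectrum M)) \<and>
          is_arg_max (\<lambda>w. w \<bullet> (M *\<^sub>v w))
            (\<lambda>w. w \<in> carrier_vec (card (\<I> i)) \<and> norm2 w = 1) v))"
proof -
  let ?\<Phi> = "Phi n \<kappa> Y lam B\<^sub>d"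
  have psd: "symmetric_psd n ?\<Phi>"
    using kappa by (intro symmetric_psd_Phi[OF Bd] lam_neg) simp
  then have \<Phi>: "?\<Phi> \<in> carrier_mat n n" "transpose_mat ?\<Phi> = ?\<Phi>"
    by (auto simp: symmetric_psd_def)
  have block: "principal_submatrix ?\<Phi> (\<I> i) \<in> carrier_mat (card (\<I> i)) (card (\<I> i))"
      "transpose_mat (principal_submatrix ?\<Phi> (\<I> i)) = principal_submatrix ?\<Phi> (\<I> i)"
      "0 < card (\<I> i)" if "i \<in> {1..r}" for i
  proof -
    \<comment> \<open>Blocks of a partition are nonempty, and they are finite as subsets of
      \<open>{..<n}\<close>. Both facts enter the positivity of the cardinality, which is the
      dimension of the block problem.\<close>
    have "\<I> i \<subseteq> {..<n}" "\<I> i \<noteq> {}"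
      using that partition_onD1[OF part(1)] partition_onD3[OF part(1)] by auto
    then show "principal_submatrix ?\<Phi> (\<I> i) \<in> carrier_mat (card (\<I> i)) (card (\<I> i))"
      "transpose_mat (principal_submatrix ?\<Phi> (\<I> i)) = principal_submatrix ?\<Phi> (\<I> i)"
      "0 < card (\<I> i)"
      using principal_submatrix_symmetric[OF \<Phi>] finite_subset[OF _ finite_lessThan]
      by (auto simp: card_gt_0_iff)
  qed
  show ?thesis
    unfolding Let_def
    using psd symmetric_rightmost_eigenvector_rayleigh[OF block] by blast
qed

end
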